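(* Let $m$ be a nonnegative integer, let $\beta$ be complex with $\Re(\beta)>\max(0,m-1)$, let $e$ be a real number with $e<1$, and let $a,c$ be real numbers such that $c-a(a+t)>0$, $c-(a+1)(a+t)>0$ and $c-(a+t)^2>0$ for all $t\in[0,1]$. Then \[ \frac{\Gamma(\beta)\Gamma(\beta)}{2\,\Gamma(2\beta)}=(c-(a+1)^2)\int_0^1 \frac{(c-a(a+t))^{\beta}\,(c-(a+1)(a+t))^{\beta-1}}{(c-(a+t)^2)^{2\beta}}\; {}_2F_1\!\left[\begin{matrix}-\beta,\ -m\\ -2\beta\end{matrix};\frac{c-(a+t)^2}{(c-a(a+t))(1-et)}\right]\left(\frac{1-et}{1-e}\right)^{m}t^{\beta-m}(1-t)^{\beta-1}\,dt . \]
   Context: Powers of positive reals are principal powers. ${}_2F_1\!\left[\begin{matrix}-\beta,-m\\ -2\beta\end{matrix};x\right]=\sum_{n=0}^{m}\frac{(-\beta)_n(-m)_n}{n!\,(-2\beta)_n}x^n$ (a polynomial in $x$), where $(x)_n=x(x+1)\cdots(x+n-1)$. *)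

theory Defs
  imports "HOL-Analysis.Analysis"
begin

definition hyp2F1_poly :: "complex \<Rightarrow> nat \<Rightarrow> complex \<Rightarrow> complex \<Rightarrow> complex" where
  "hyp2F1_poly b m g x =
     (\<Sum>n\<le>m. pochhammer b n * pochhammer (- of_nat m) n / (fact n * pochhammer g n) * x ^ n)"

end

theory Submission
  imports Defs
begin

text \<open>
  Let \<open>A, B, D\<close> be \<open>c - a (a + t)\<close>, \<open>c - (a + 1) (a + t)\<close>, \<open>c - (a + t)\<^sup>2\<close>.
  Since \<open>t B + (1 - t) A = D\<close>, the map \<open>u = t B / D\<close> is an increasing bijection of the unit
  interval with \<open>1 - u = (1 - t) A / D\<close>. Writing \<open>1 - e t = (1 - t) + t (1 - e)\<close> and expanding,
  the integrand becomes a combination of powers \<open>(1 - e) ^ (-j)\<close>, whose coefficients involve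
  \<open>(u (1 - u)) powr (\<beta> - 1)\<close>, a Gegenbauer-type polynomial \<open>G\<^sub>j(u)\<close> with \<open>G\<^sub>j(1 - u) = (-1)^j G\<^sub>j(u)\<close>,
  and \<open>y ^ (j - 1)\<close> for \<open>y = D / (A t)\<close>. As a function of \<open>u\<close>, \<open>u (1 - u) y\<close> is a constant times \<open>v + h\<close>,
  where \<open>v > 0\<close> is a square root invariant under \<open>u \<mapsto> 1 - u\<close>, \<open>h\<close> is a multiple of \<open>1 - 2 u\<close>, and \<open>du = v dt / D\<close>.
  Averaging the integrand over \<open>u \<mapsto> 1 - u\<close> removes the square root: for \<open>j = 0\<close> a
  Beta integral remains, and for \<open>j > 0\<close> what is left is \<open>G\<^sub>j\<close> times a polynomial of degree less
  than \<open>j\<close>, which integrates to zero against \<open>(u (1 - u)) powr (\<beta> - j)\<close> by Chu-Vandermonde.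
\<close>

section \<open>A Gegenbauer-type polynomial\<close>

lemma pochhammer_neg_of_nat:
  "pochhammer (- of_nat n) k / fact k = (-1) ^ k * (of_nat (n choose k) :: 'a :: field_char_0)"
proof -
  have "of_nat (n choose k) = (of_nat n gchoose k :: 'a)"
    by (simp add: binomial_gbinomial)
  also have "\<dots> = (-1) ^ k * pochhammer (- of_nat n) k / fact k"
    by (simp add: gbinomial_pochhammer)
  finally show ?thesis
    by (simp add: mult.assoc [symmetric] power_mult_distrib [symmetric])
qed

text \<open>After multiplication by \<open>pochhammer x n\<close>, the factor
  \<open>pochhammer (x + k) (n - k)\<close> read backwards is, up to sign, a rising factorial of
  \<open>1 - x - n\<close>. The sum is then an instance of the binomial theorem for rising
  factorials.\<close>

lemma chu_vandermonde:
  fixes b x :: "'a :: field_char_0"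
  assumes "pochhammer x n \<noteq> 0"
  shows "(\<Sum>k\<le>n. pochhammer b k * pochhammer (- of_nat n) k / (fact k * pochhammer x k)) =
         pochhammer (x - b) n / pochhammer x n"
proof -
  have "pochhammer x n * (\<Sum>k\<le>n. pochhammer b k * pochhammer (- of_nat n) k / (fact k * pochhammer x k))
      = (\<Sum>k\<le>n. (-1) ^ n * (of_nat (n choose k) * pochhammer b k * pochhammer (1 - x - of_nat n) (n - k)))"
    unfolding sum_distrib_left
  proof (intro sum.cong refl)
    fix k assume "k \<in> {..n}"
    hence k: "k \<le> n" by simp
    have prod: "pochhammer x n = pochhammer x k * pochhammer (x + of_nat k) (n - k)"
      using k by (rule pochhammer_product)
    hence nz: "pochhammer x k \<noteq> 0" using assms by auto
    have "pochhammer (- (x + of_nat n - 1)) (n - k) = 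
            (-1) ^ (n - k) * pochhammer (x + of_nat n - 1 - of_nat (n - k) + 1) (n - k)"
      by (rule pochhammer_minus)
    also have "x + of_nat n - 1 - of_nat (n - k) + 1 = x + of_nat k"
      using k by (simp add: of_nat_diff)
    also have "- (x + of_nat n - 1) = 1 - x - of_nat n" by simp
    finally have "pochhammer (x + of_nat k) (n - k) = (-1) ^ (n - k) * pochhammer (1 - x - of_nat n) (n - k)"
      by (simp add: mult.assoc [symmetric] power_mult_distrib [symmetric])
    moreover have "(-1 :: 'a) ^ n = (-1) ^ k * (-1) ^ (n - k)"
      using k by (simp flip: power_add)
    ultimately show "pochhammer x n * (pochhammer b k * pochhammer (- of_nat n) k / (fact k * pochhammer x k)) =
      (-1) ^ n * (of_nat (n choose k) * pochhammer b k * pochhammer (1 - x - of_nat n) (n - k))"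
      using nz pochhammer_neg_of_nat[of n k, where ?'a = 'a] by (simp add: prod field_simps)
  qed
  also have "\<dots> = (-1) ^ n * pochhammer (b + (1 - x - of_nat n)) n"
    by (simp add: pochhammer_binomial_sum sum_distrib_left)
  also have "b + (1 - x - of_nat n) = - (x - b + of_nat n - 1)" by simp
  also have "(-1) ^ n * pochhammer (- (x - b + of_nat n - 1)) n = pochhammer (x - b) n"
    by (subst pochhammer_minus) (simp add: mult.assoc [symmetric] power_mult_distrib [symmetric])
  finally show ?thesis using assms by (simp add: field_simps)
qed

text \<open>
  Up to normalisation the Gegenbauer polynomial of degree \<open>j\<close> and parameter \<open>\<beta> - j + 1/2\<close>
  in \<open>1 - 2 u\<close>; it is \<open>(1 - u) ^ j\<close> times the hypergeometric polynomial at \<open>1 / (1 - u)\<close>.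
\<close>
definition ultra :: "complex \<Rightarrow> nat \<Rightarrow> complex \<Rightarrow> complex" where
  "ultra \<beta> j u = (\<Sum>n\<le>j. pochhammer (- \<beta>) n * pochhammer (- of_nat j) n /
      (fact n * pochhammer (- 2 * \<beta>) n) * (1 - u) ^ (j - n))"

text \<open>Expand \<open>(1 - u) ^ (j - n)\<close> in powers of \<open>- u\<close>. Chu-Vandermonde
  evaluates each new coefficient, and because the lower parameter is twice the upper one,
  \<open>x - b\<close> is again \<open>b\<close>: up to sign the old coefficients return in reverse
  order.\<close>

lemma ultra_reflect:
  assumes "pochhammer (- 2 * \<beta>) j \<noteq> 0"
  shows "ultra \<beta> j (1 - u) = (-1) ^ j * ultra \<beta> j u"
proof -
  define c where "c = (\<lambda>n. pochhammer (- \<beta>) n * pochhammer (- of_nat j) n /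
      (fact n * pochhammer (- 2 * \<beta>) n))"
  define d where "d = (\<lambda>k. of_nat (j choose k) * pochhammer (- \<beta>) (j - k) / pochhammer (- 2 * \<beta>) (j - k))"
  have ultra: "ultra \<beta> j v = (\<Sum>n\<le>j. c n * (1 - v) ^ (j - n))" for v
    by (simp add: ultra_def c_def)
  have d: "(\<Sum>n\<le>j-k. c n * of_nat ((j - n) choose k)) = d k" if k: "k \<le> j" for k
  proof -
    have nz: "pochhammer (- 2 * \<beta>) (j - k) \<noteq> 0"
      using assms pochhammer_product[of "j - k" j "- 2 * \<beta>"] by auto
    have "(\<Sum>n\<le>j-k. c n * of_nat ((j - n) choose k)) =
          (\<Sum>n\<le>j-k. of_nat (j choose k) * (pochhammer (- \<beta>) n * pochhammer (- of_nat (j - k)) n /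
              (fact n * pochhammer (- 2 * \<beta>) n)))"
    proof (intro sum.cong refl)
      fix n assume "n \<in> {..j-k}"
      hence n: "n + k \<le> j" using k by simp
      \<comment> \<open>Both products count pairs of disjoint subsets of sizes \<open>n\<close> and
        \<open>k\<close>; they are compared through \<open>j choose (n + k)\<close>.\<close>
      have "(j choose n) * ((j - n) choose k) = (j choose k) * ((j - k) choose n)"
        using choose_mult[of n "n + k" j] choose_mult[of k "n + k" j] n binomial_symmetric[of k "n + k"]
        by simp
      hence "of_nat (j choose n) * of_nat ((j - n) choose k) = (of_nat (j choose k) * of_nat ((j - k) choose n) :: complex)"
        by (simp flip: of_nat_mult)
      hence "pochhammer (- of_nat j) n / fact n * of_nat ((j - n) choose k) =
          of_nat (j choose k) * (pochhammer (- of_nat (j - k)) n / fact n :: complex)"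
        unfolding pochhammer_neg_of_nat by (simp add: mult_ac)
      hence "pochhammer (- \<beta>) n / pochhammer (- 2 * \<beta>) n * (pochhammer (- of_nat j) n / fact n * of_nat ((j - n) choose k)) =
          pochhammer (- \<beta>) n / pochhammer (- 2 * \<beta>) n * (of_nat (j choose k) * (pochhammer (- of_nat (j - k)) n / fact n :: complex))"
        by simp
      thus "c n * of_nat ((j - n) choose k) = of_nat (j choose k) * (pochhammer (- \<beta>) n * pochhammer (- of_nat (j - k)) n /
              (fact n * pochhammer (- 2 * \<beta>) n))"
        by (simp add: c_def mult_ac)
    qed
    also have "\<dots> = d k"
      unfolding sum_distrib_left [symmetric] chu_vandermonde[OF nz] by (simp add: d_def)
    finally show ?thesis .
  qed
  have c: "c (j - k) = (-1) ^ (j - k) * d k" if k: "k \<le> j" for k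
    using pochhammer_neg_of_nat[of j "j - k", where ?'a = complex] binomial_symmetric[OF k]
    by (simp add: c_def d_def field_simps)
  have "ultra \<beta> j u = (\<Sum>n\<le>j. \<Sum>k\<le>j-n. c n * of_nat ((j - n) choose k) * (- u) ^ k)"
    unfolding ultra
  proof (intro sum.cong refl)
    fix n
    have "(1 - u) ^ (j - n) = (- u + 1) ^ (j - n)" by simp
    also have "\<dots> = (\<Sum>k\<le>j-n. of_nat ((j - n) choose k) * (- u) ^ k)"
      by (simp only: binomial_ring power_one mult_1_right)
    finally show "c n * (1 - u) ^ (j - n) = (\<Sum>k\<le>j-n. c n * of_nat ((j - n) choose k) * (- u) ^ k)"
      by (simp add: sum_distrib_left mult_ac)
  qed
  also have "\<dots> = (\<Sum>k\<le>j. \<Sum>n\<le>j-k. c n * of_nat ((j - n) choose k) * (- u) ^ k)"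
    by (simp add: sum.Sigma, rule sum.reindex_bij_witness[of _ prod.swap prod.swap]) auto
  also have "\<dots> = (\<Sum>k\<le>j. d k * (- u) ^ k)"
    by (simp add: d flip: sum_distrib_right)
  also have "\<dots> = (\<Sum>k\<le>j. (-1) ^ j * (c (j - k) * u ^ (j - (j - k))))"
  proof (intro sum.cong refl)
    fix k assume "k \<in> {..j}"
    hence k: "k \<le> j" by simp
    have "(-1 :: complex) ^ j = (-1) ^ (j - k) * (-1) ^ k" using k by (simp flip: power_add)
    moreover have "((-1 :: complex) ^ (j - k)) * (-1) ^ (j - k) = 1" 
      by (simp flip: power_mult_distrib)
    moreover have "(- u) ^ k = (-1) ^ k * u ^ k" by (simp flip: power_mult_distrib)
    ultimately show "d k * (- u) ^ k = (-1) ^ j * (c (j - k) * u ^ (j - (j - k)))"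
      using k by (simp add: c mult_ac)
  qed
  also have "\<dots> = (-1) ^ j * (\<Sum>n\<le>j. c n * u ^ (j - n))"
    unfolding sum_distrib_left [symmetric]
    using sum.nat_diff_reindex[of "\<lambda>n. c n * u ^ (j - n)" "Suc j"] by (simp add: lessThan_Suc_atMost)
  also have "(\<Sum>n\<le>j. c n * u ^ (j - n)) = ultra \<beta> j (1 - u)"
    by (simp add: ultra)
  finally show ?thesis by (simp flip: mult.assoc power_mult_distrib)
qed

section \<open>The Beta integral with complex parameters\<close>

text \<open>On the real line the branch cut is harmless: the principal logarithm is
  \<open>ln \<bar>t\<bar>\<close>, plus \<open>\<i> * pi\<close> for negative \<open>t\<close>, and
  \<open>powr\<close> defaults to 0 at base 0.\<close>

lemma borel_measurable_of_real_powr [measurable]: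
  assumes [measurable]: "g \<in> borel_measurable M"
  shows "(\<lambda>x. complex_of_real (g x) powr z) \<in> borel_measurable M"
proof -
  have "(\<lambda>t. complex_of_real t powr z) = (\<lambda>t. if t = 0 then 0
     else exp (z * (of_real (ln \<bar>t\<bar>) + (if t < 0 then \<i> * of_real pi else 0))))"
  proof
    fix t :: real
    show "complex_of_real t powr z = (if t = 0 then 0
       else exp (z * (of_real (ln \<bar>t\<bar>) + (if t < 0 then \<i> * of_real pi else 0))))"
      by (cases t "0 :: real" rule: linorder_cases)
         (auto simp: powr_def Ln_of_real Ln_of_real' algebra_simps)
  qed
  also have "\<dots> \<in> borel_measurable borel" by measurable
  finally have [measurable]: "(\<lambda>t. complex_of_real t powr z) \<in> borel_measurable borel" .
  show ?thesis by measurable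
qed

text \<open>The norm of each power depends only on the real part of its exponent, so the real Beta
  integrand serves as dominating function.\<close>

lemma absolutely_integrable_Beta_complex:
  assumes "Re a > 0" "Re b > 0"
  shows "(\<lambda>t. complex_of_real t powr (a - 1) * of_real (1 - t) powr (b - 1)) absolutely_integrable_on {0..1}"
proof (rule measurable_bounded_by_integrable_imp_absolutely_integrable)
  show "(\<lambda>t. t powr (Re a - 1) * (1 - t) powr (Re b - 1)) integrable_on {0..1}"
    using assms by (intro integrable_Beta') auto
  show "(\<lambda>t. complex_of_real t powr (a - 1) * of_real (1 - t) powr (b - 1)) \<in> borel_measurable (lebesgue_on {0..1})"
    by (intro measurable_restrict_space1 measurable_completion) (simp del: of_real_diff)
qed (auto simp: norm_mult norm_powr_real_powr)

text \<open>As in the real case, \<open>\<Gamma>(a) \<Gamma>(b)\<close> is the integral of a convolution, evaluated by Fubini.\<close>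
theorem has_integral_Beta_complex:
  assumes a: "Re a > 0" and b: "Re b > 0"
  shows "((\<lambda>t. complex_of_real t powr (a - 1) * of_real (1 - t) powr (b - 1)) has_integral Beta a b) {0..1}"
proof -
  \<comment> \<open>The Gamma integrand is extended by zero to the whole line, so that the
    convolution carries no bounds of integration.\<close>
  define g where "g = (\<lambda>z t. indicator {0<..} t *\<^sub>R (complex_of_real t powr (z - 1) / of_real (exp t)))"
  have [measurable]: "g z \<in> borel_measurable borel" for z
    unfolding g_def by measurable
  have g: "has_bochner_integral lborel (g z) (Gamma z)" if "Re z > 0" for z
  proof -
    have "set_integrable lebesgue {0<..} (\<lambda>t. complex_of_real t powr (z - 1) / of_real (exp t))"
      using absolutely_integrable_Gamma_integral'[OF that] by simp
    hence "integrable lebesgue (g z)"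
      by (simp add: g_def set_integrable_def)
    hence int: "integrable lborel (g z)" 
      by (simp add: integrable_completion)
    have "(g z has_integral integral\<^sup>L lborel (g z)) UNIV"
      by (rule has_integral_integral_lborel[OF int])
    moreover have "(g z has_integral Gamma z) UNIV"
    proof -
      have "g z = (\<lambda>t. if t \<in> {0<..} then complex_of_real t powr (z - 1) / of_real (exp t) else 0)"
        by (auto simp: g_def)
      thus ?thesis
        using Gamma_integral_complex'[OF that] by (simp only: has_integral_restrict_UNIV)
    qed
    ultimately have "integral\<^sup>L lborel (g z) = Gamma z"
      by (rule has_integral_unique)
    with int show ?thesis by (simp add: has_bochner_integral_iff)
  qed
  note int = g[unfolded has_bochner_integral_iff, THEN conjunct1]
  note val = g[unfolded has_bochner_integral_iff, THEN conjunct2]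
  define B where "B = integral {0..1} (\<lambda>t. complex_of_real t powr (a - 1) * of_real (1 - t) powr (b - 1))"
  have B: "(\<integral>t. indicator {0..1} t *\<^sub>R (complex_of_real t powr (a - 1) * of_real (1 - t) powr (b - 1)) \<partial>lborel) = B"
  proof -
    have "set_integrable lborel {0..1} (\<lambda>t. complex_of_real t powr (a - 1) * of_real (1 - t) powr (b - 1))"
      using absolutely_integrable_Beta_complex[OF a b] unfolding set_integrable_def
      by (subst (asm) integrable_completion) (auto simp del: of_real_diff)
    from set_borel_integral_eq_integral(2)[OF this] show ?thesis
      by (simp add: B_def set_lebesgue_integral_def)
  qed
  interpret lborel_pair: pair_sigma_finite lborel lborel ..
  \<comment> \<open>By translation invariance the inner integral over \<open>u\<close> does not
    depend on \<open>t\<close>. This yields both the hypothesis of Fubini and the product of Gamma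
    values.\<close>
  have shift: "integrable lborel (\<lambda>u. g b (u - t))" "(\<integral>u. g b (u - t) \<partial>lborel) = Gamma b" 
    "(\<integral>u. norm (g b (u - t)) \<partial>lborel) = (\<integral>u. norm (g b u) \<partial>lborel)" for t
    using lborel_integrable_real_affine[OF int[OF b], of 1 "-t"]
      lborel_integral_real_affine[of 1 "g b" "-t"] val[OF b]
      lborel_integral_real_affine[of 1 "\<lambda>u. norm (g b u)" "-t"] by simp_all
  have int2: "integrable (lborel \<Otimes>\<^sub>M lborel) (\<lambda>(t, u). g a t * g b (u - t))"
  proof (rule lborel_pair.Fubini_integrable)
    show "(\<lambda>(t, u). g a t * g b (u - t)) \<in> borel_measurable (lborel \<Otimes>\<^sub>M lborel)"
      by measurable
    show "integrable lborel (\<lambda>t. \<integral>u. norm (case (t, u) of (t, u) \<Rightarrow> g a t * g b (u - t)) \<partial>lborel)"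
      using int[OF a] by (simp add: norm_mult shift)
    show "AE t in lborel. integrable lborel (\<lambda>u. case (t, u) of (t, u) \<Rightarrow> g a t * g b (u - t))"
      using shift by simp
  qed
  have conv: "(\<integral>t. g a t * g b (u - t) \<partial>lborel) = g (a + b) u * B" if "u \<noteq> 0" for u
  proof (cases "u > 0")
    case False
    hence "(\<lambda>t. g a t * g b (u - t)) = (\<lambda>_. 0)" by (auto simp: g_def indicator_def)
    thus ?thesis using False by (simp add: g_def)
  next
    case True
    \<comment> \<open>Scaling by \<open>u\<close> moves the support onto the unit interval. The
      exponentials combine to \<open>exp u\<close>, and the Jacobian raises the exponent of
      \<open>u\<close> from \<open>a + b - 2\<close> to \<open>a + b - 1\<close>.\<close>
    have "(\<integral>t. g a t * g b (u - t) \<partial>lborel) = u *\<^sub>R (\<integral>t. g a (u * t) * g b (u - u * t) \<partial>lborel)"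
      using True lborel_integral_real_affine[of u "\<lambda>t. g a t * g b (u - t)" 0] by simp
    also have "(\<integral>t. g a (u * t) * g b (u - u * t) \<partial>lborel) =
      (\<integral>t. complex_of_real u powr (a + b - 2) / of_real (exp u) * 
         (indicator {0..1} t *\<^sub>R (complex_of_real t powr (a - 1) * of_real (1 - t) powr (b - 1))) \<partial>lborel)"
    proof (intro Bochner_Integration.integral_cong refl)
      fix t :: real
      show "g a (u * t) * g b (u - u * t) = complex_of_real u powr (a + b - 2) / of_real (exp u) * 
         (indicator {0..1} t *\<^sub>R (complex_of_real t powr (a - 1) * of_real (1 - t) powr (b - 1)))"
      proof (cases "t \<in> {0<..<1}")
        case t: True
        have *: "u - u * t = u * (1 - t)" by (simp add: algebra_simps)
        have "exp (u * t) * exp (u * (1 - t)) = exp u"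
          by (simp add: algebra_simps flip: exp_add)
        hence "complex_of_real (exp (u * t)) * of_real (exp (u * (1 - t))) = of_real (exp u)"
          by (simp flip: of_real_mult)
        moreover have "complex_of_real u powr (a + b - 2) = of_real u powr (a - 1) * of_real u powr (b - 1)"
          by (simp flip: powr_add)
        ultimately show ?thesis
          using t True unfolding * 
          by (simp add: g_def powr_times_real mult_ac del: of_real_diff)
      next
        case False
        hence "t \<le> 0 \<or> t \<ge> 1" by auto
        thus ?thesis using True 
          by (auto simp: g_def indicator_def zero_less_mult_iff)
      qed
    qed
    also have "u *\<^sub>R \<dots> = of_real u * complex_of_real u powr (a + b - 2) / of_real (exp u) * B"
      by (simp only: integral_mult_right_zero B) (simp add: scaleR_conv_of_real)
    also have "of_real u * complex_of_real u powr (a + b - 2) = of_real u powr (a + b - 1)"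
    proof -
      have "complex_of_real u powr (1 + (a + b - 2)) = of_real u * complex_of_real u powr (a + b - 2)"
        using True by (subst powr_add) simp
      thus ?thesis by (simp add: algebra_simps)
    qed
    finally show ?thesis using True by (simp add: g_def)
  qed
  have "Gamma a * Gamma b = (\<integral>t. (\<integral>u. g a t * g b (u - t) \<partial>lborel) \<partial>lborel)"
    using val[OF a] by (simp add: shift)
  also have "\<dots> = (\<integral>u. (\<integral>t. g a t * g b (u - t) \<partial>lborel) \<partial>lborel)"
    using lborel_pair.Fubini_integral[OF int2] by simp
  also have "\<dots> = (\<integral>u. g (a + b) u * B \<partial>lborel)"
    by (intro integral_cong_AE AE_I2 eventually_mono[OF AE_lborel_singleton[of 0]] conv) auto
  also have "\<dots> = Gamma (a + b) * B"
    using val[of "a + b"] int[of "a + b"] a b by simp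
  finally have "Gamma a * Gamma b = Gamma (a + b) * B" .
  \<comment> \<open>\<open>Gamma\<close> is 0 only at its poles, by convention; the positive real
    part of \<open>a + b\<close> excludes them.\<close>
  moreover have "Gamma (a + b) \<noteq> 0"
  proof
    assume "Gamma (a + b) = 0"
    then obtain n where n: "a + b = of_int n" "n \<le> 0"
      by (auto simp: Gamma_eq_zero_iff elim!: nonpos_Ints_cases)
    from n(1) have "Re a + Re b = of_int n"
      by (metis complex_Re_of_int plus_complex.sel(1))
    with n(2) a b show False by linarith
  qed
  ultimately have "B = Beta a b" by (simp add: Beta_def field_simps)
  thus ?thesis
    using absolutely_integrable_Beta_complex[OF a b]
    by (simp add: B_def has_integral_iff absolutely_integrable_on_def)
qed

section \<open>Orthogonality\<close>

text \<open>Termwise integration gives Beta values that depend on \<open>n\<close> through quotients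
  of rising factorials. Chu-Vandermonde sums them to a multiple of
  \<open>pochhammer (- of_nat N) j\<close>, which vanishes because \<open>N = j - 1 - k\<close> is
  less than \<open>j\<close>.\<close>

lemma has_integral_ultra_moment:
  assumes \<beta>: "Re \<beta> > real j - 1" and nz: "pochhammer (- 2 * \<beta>) j \<noteq> 0" and k: "k < j"
  shows "((\<lambda>u. complex_of_real u powr (\<beta> - of_nat j) * of_real (1 - u) powr (\<beta> - of_nat j) *
            (ultra \<beta> j (of_real u) * of_real u ^ k)) has_integral 0) {0..1}"
proof -
  define N where "N = j - 1 - k"
  have N: "of_nat N = (of_nat j - 1 - of_nat k :: complex)" "N < j"
    using k by (simp_all add: N_def of_nat_diff)
  define c where "c = (\<lambda>n. pochhammer (- \<beta>) n * pochhammer (- of_nat j) n /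
      (fact n * pochhammer (- 2 * \<beta>) n))"
  \<comment> \<open>This is the Beta value for \<open>n = 0\<close>, which factors out of all the
    others. It uses \<open>rGamma\<close> because the shift relation of \<open>rGamma\<close> has no
    side condition.\<close>
  define C where "C = Gamma (\<beta> - of_nat j + of_nat k + 1) * Gamma (\<beta> + 1) * rGamma (2 * \<beta> + 1 - of_nat N)"
  have "((\<lambda>u. \<Sum>n\<le>j. c n * (complex_of_real u powr (\<beta> - of_nat j + of_nat k + 1 - 1) * of_real (1 - u) powr (\<beta> - of_nat n + 1 - 1)))
     has_integral (\<Sum>n\<le>j. c n * Beta (\<beta> - of_nat j + of_nat k + 1) (\<beta> - of_nat n + 1))) {0..1}"
    using \<beta> by (intro has_integral_sum has_integral_mult_right has_integral_Beta_complex) auto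
  also have "(\<Sum>n\<le>j. c n * Beta (\<beta> - of_nat j + of_nat k + 1) (\<beta> - of_nat n + 1)) =
    (\<Sum>n\<le>j. C * (pochhammer (of_nat N - 2 * \<beta>) n * pochhammer (- of_nat j) n /
      (fact n * pochhammer (- 2 * \<beta>) n)))"
  proof (intro sum.cong refl)
    fix n assume "n \<in> {..j}"
    hence n: "n \<le> j" by simp
    have "\<beta> - of_nat n + 1 \<notin> \<int>\<^sub>\<le>\<^sub>0"
      using \<beta> n by (auto elim!: nonpos_Ints_cases simp: complex_eq_iff)
    hence "Gamma (\<beta> - of_nat n + 1) \<noteq> 0" by (simp add: Gamma_eq_zero_iff)
    hence G: "Gamma (\<beta> + 1) = pochhammer (\<beta> - of_nat n + 1) n * Gamma (\<beta> - of_nat n + 1)"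
      using \<open>\<beta> - of_nat n + 1 \<notin> \<int>\<^sub>\<le>\<^sub>0\<close> by (subst pochhammer_Gamma) (auto simp: field_simps)
    have r: "rGamma (2 * \<beta> + 1 - of_nat N - of_nat n) = 
        pochhammer (2 * \<beta> - of_nat N - of_nat n + 1) n * rGamma (2 * \<beta> + 1 - of_nat N)"
      by (subst pochhammer_rGamma[of _ n]) (simp add: algebra_simps)
    have p: "pochhammer (- \<beta>) n = (-1) ^ n * pochhammer (\<beta> - of_nat n + 1) n"
      by (rule pochhammer_minus)
    have p': "pochhammer (of_nat N - 2 * \<beta>) n = (-1) ^ n * pochhammer (2 * \<beta> - of_nat N - of_nat n + 1) n"
      using pochhammer_minus[of "2 * \<beta> - of_nat N" n] by simp
    have B: "Beta (\<beta> - of_nat j + of_nat k + 1) (\<beta> - of_nat n + 1) =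
       Gamma (\<beta> - of_nat j + of_nat k + 1) * Gamma (\<beta> - of_nat n + 1) * rGamma (2 * \<beta> + 1 - of_nat N - of_nat n)"
      by (simp add: Beta_altdef N algebra_simps)
    show "c n * Beta (\<beta> - of_nat j + of_nat k + 1) (\<beta> - of_nat n + 1) =
      C * (pochhammer (of_nat N - 2 * \<beta>) n * pochhammer (- of_nat j) n / (fact n * pochhammer (- 2 * \<beta>) n))"
      unfolding c_def C_def B r p p' G by (simp add: mult_ac)
  qed
  also have "\<dots> = C * (pochhammer (- of_nat N) j / pochhammer (- 2 * \<beta>) j)"
    unfolding sum_distrib_left [symmetric] chu_vandermonde[OF nz] by simp
  also have "pochhammer (- of_nat N) j = (0 :: complex)"
    using N(2) by (simp add: pochhammer_of_nat_eq_0_iff)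
  finally have "((\<lambda>u. \<Sum>n\<le>j. c n * (complex_of_real u powr (\<beta> - of_nat j + of_nat k + 1 - 1) * 
      of_real (1 - u) powr (\<beta> - of_nat n + 1 - 1))) has_integral 0) {0<..<1}"
    by (simp add: has_integral_Icc_iff_Ioo)
  \<comment> \<open>On the open interval both bases are nonzero, so integer parts of the exponents
    split off as ordinary powers.\<close>
  hence "((\<lambda>u. complex_of_real u powr (\<beta> - of_nat j) * of_real (1 - u) powr (\<beta> - of_nat j) *
            (ultra \<beta> j (of_real u) * of_real u ^ k)) has_integral 0) {0<..<1}"
  proof (rule has_integral_eq [rotated])
    fix u :: real assume u: "u \<in> {0<..<1}"
    have "complex_of_real u powr (\<beta> - of_nat j + of_nat k + 1 - 1) * of_real (1 - u) powr (\<beta> - of_nat n + 1 - 1) =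
      of_real u powr (\<beta> - of_nat j) * of_real (1 - u) powr (\<beta> - of_nat j) * (of_real (1 - u) ^ (j - n) * of_real u ^ k)"
      if "n \<le> j" for n
    proof -
      have "complex_of_real u powr (\<beta> - of_nat j + of_nat k + 1 - 1) = of_real u powr (\<beta> - of_nat j) * of_real u ^ k"
        using u by (simp add: powr_add)
      moreover have "\<beta> - of_nat n + 1 - 1 = (\<beta> - of_nat j) + of_nat (j - n)"
        using that by (simp add: of_nat_diff)
      hence "complex_of_real (1 - u) powr (\<beta> - of_nat n + 1 - 1) = of_real (1 - u) powr (\<beta> - of_nat j) * of_real (1 - u) ^ (j - n)"
        using u by (simp only: powr_add powr_complexpow) simp
      ultimately show ?thesis by (simp add: mult_ac)
    qed
    thus "(\<Sum>n\<le>j. c n * (complex_of_real u powr (\<beta> - of_nat j + of_nat k + 1 - 1) * 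
      of_real (1 - u) powr (\<beta> - of_nat n + 1 - 1))) = complex_of_real u powr (\<beta> - of_nat j) * of_real (1 - u) powr (\<beta> - of_nat j) *
            (ultra \<beta> j (of_real u) * of_real u ^ k)"
      by (simp add: ultra_def c_def [symmetric] sum_distrib_left sum_distrib_right mult_ac del: of_real_diff)
         (simp add: c_def mult_ac)
  qed
  thus ?thesis by (simp add: has_integral_Icc_iff_Ioo)
qed

lemma has_integral_ultra_poly:
  fixes p :: "real poly"
  assumes \<beta>: "Re \<beta> > real j - 1" and nz: "pochhammer (- 2 * \<beta>) j \<noteq> 0" and p: "degree p < j"
  shows "((\<lambda>u. complex_of_real u powr (\<beta> - of_nat j) * of_real (1 - u) powr (\<beta> - of_nat j) *
            (ultra \<beta> j (of_real u) * of_real (poly p u))) has_integral 0) {0..1}"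
proof -
  have "((\<lambda>u. \<Sum>k\<le>degree p. of_real (coeff p k) * (complex_of_real u powr (\<beta> - of_nat j) * of_real (1 - u) powr (\<beta> - of_nat j) *
            (ultra \<beta> j (of_real u) * of_real u ^ k))) has_integral (\<Sum>k\<le>degree p. of_real (coeff p k) * 0)) {0..1}"
    using p by (intro has_integral_sum has_integral_mult_right has_integral_ultra_moment \<beta> nz) auto
  thus ?thesis by (simp add: poly_altdef sum_distrib_left mult_ac)
qed

section \<open>Symmetrisation of Beta-weighted integrals\<close>

lemma absolutely_integrable_Beta_continuous:
  fixes g :: "real \<Rightarrow> complex"
  assumes "Re a > 0" "Re b > 0" and g: "continuous_on {0..1} g"
  shows "(\<lambda>u. complex_of_real u powr (a - 1) * of_real (1 - u) powr (b - 1) * g u) absolutely_integrable_on {0..1}"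
proof -
  have "(\<lambda>u. g u * (complex_of_real u powr (a - 1) * of_real (1 - u) powr (b - 1))) absolutely_integrable_on {0..1}"
  proof (rule absolutely_integrable_bounded_measurable_product[where h = times and f = g])
    show "bilinear (times :: complex \<Rightarrow> _)"
      by (simp add: bilinear_conv_bounded_bilinear bounded_bilinear_mult)
    show "g \<in> borel_measurable (lebesgue_on {0..1})"
      using g by (intro continuous_imp_measurable_on_sets_lebesgue) auto
    show "bounded (g ` {0..1})"
      using g by (intro compact_imp_bounded compact_continuous_image) auto
    show "(\<lambda>u. complex_of_real u powr (a - 1) * of_real (1 - u) powr (b - 1)) absolutely_integrable_on {0..1}"
      using assms by (intro absolutely_integrable_Beta_complex)
  qed auto
  thus ?thesis by (simp add: mult_ac)
qed

text \<open>The weight is invariant under the reflection, so \<open>g u\<close> and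
  \<open>g (1 - u)\<close> contribute equally. Continuity of \<open>g\<close> supplies integrability
  of each summand, which integrability of the sum alone would not give.\<close>

lemma has_integral_Beta_symmetrise:
  fixes g :: "real \<Rightarrow> complex"
  assumes "Re a > 0" and g: "continuous_on {0..1} g"
    and I: "((\<lambda>u. complex_of_real u powr (a - 1) * of_real (1 - u) powr (a - 1) * (g u + g (1 - u))) has_integral I) {0..1}"
  shows "((\<lambda>u. complex_of_real u powr (a - 1) * of_real (1 - u) powr (a - 1) * g u) has_integral I / 2) {0..1}"
proof -
  let ?f = "\<lambda>u. complex_of_real u powr (a - 1) * of_real (1 - u) powr (a - 1) * g u"
  have f: "?f absolutely_integrable_on {0..1}"
    using assms by (intro absolutely_integrable_Beta_continuous)
  have im: "(\<lambda>u. 1 - u) ` {0..1} = {0..1 :: real}"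
    by (simp add: image_diff_atLeastAtMost)
  have "(\<lambda>u. \<bar>-1\<bar> *\<^sub>R ?f (1 - u)) absolutely_integrable_on {0..1} \<and>
        integral {0..1} (\<lambda>u. \<bar>-1\<bar> *\<^sub>R ?f (1 - u)) = integral {0..1} ?f"
    using f by (subst has_absolute_integral_change_of_variables_real[where g = "\<lambda>u. 1 - u"])
       (auto intro!: derivative_eq_intros inj_onI simp: im)
  hence "((\<lambda>u. ?f (1 - u)) has_integral integral {0..1} ?f) {0..1}"
    by (simp add: has_integral_iff absolutely_integrable_on_def)
  moreover have "(?f has_integral integral {0..1} ?f) {0..1}"
    using f by (simp add: has_integral_iff absolutely_integrable_on_def)
  ultimately have "((\<lambda>u. ?f u + ?f (1 - u)) has_integral integral {0..1} ?f + integral {0..1} ?f) {0..1}"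
    by (intro has_integral_add)
  also have "(\<lambda>u. ?f u + ?f (1 - u)) = (\<lambda>u. complex_of_real u powr (a - 1) * of_real (1 - u) powr (a - 1) * (g u + g (1 - u)))"
    by (simp add: algebra_simps)
  finally have "integral {0..1} ?f + integral {0..1} ?f = I"
    using I by (rule has_integral_unique)
  hence "integral {0..1} ?f = I / 2" by (simp add: field_simps)
  thus ?thesis
    using f by (simp add: has_integral_iff absolutely_integrable_on_def)
qed

section \<open>The quadratic substitution\<close>

text \<open>An odd polynomial in \<open>v\<close> is \<open>v\<close> times a polynomial in \<open>v\<^sup>2 = x\<^sup>2 - q\<close>.\<close>
lemma power_diff_poly:
  fixes x q :: "real poly"
  assumes x: "degree x \<le> 1" and q: "degree q \<le> 2"
  shows "\<exists>p. degree p \<le> n \<and> (\<forall>u v. poly x u ^ 2 - v ^ 2 = poly q u \<longrightarrow>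
    (poly x u + v) ^ n - (poly x u - v) ^ n = v * poly p u)"
proof (induction n rule: induct_nat_012)
  case (ge2 n)
  then obtain p p' where p: "degree p \<le> n" "degree p' \<le> Suc n"
    "\<And>u v. poly x u ^ 2 - v ^ 2 = poly q u \<Longrightarrow> (poly x u + v) ^ n - (poly x u - v) ^ n = v * poly p u"
    "\<And>u v. poly x u ^ 2 - v ^ 2 = poly q u \<Longrightarrow> (poly x u + v) ^ Suc n - (poly x u - v) ^ Suc n = v * poly p' u"
    by blast
  show ?case
  proof (intro exI conjI allI impI)
    \<comment> \<open>For fixed \<open>u\<close>, \<open>x + v\<close> and \<open>x - v\<close> are
      the roots of \<open>z^2 - 2 * x * z + q\<close>, so differences of their powers obey the
      matching two-term recurrence. The witness is that recurrence after removal of the factor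
      \<open>v\<close>.\<close>
    show "degree (smult 2 (x * p') - q * p) \<le> Suc (Suc n)"
      using degree_mult_le[of x p'] degree_mult_le[of q p] x q p(1,2)
      by (intro degree_diff_le) (auto intro: order.trans[OF degree_smult_le])
    fix u v assume v: "(poly x u)\<^sup>2 - v\<^sup>2 = poly q u"
    have "(poly x u + v) ^ Suc (Suc n) - (poly x u - v) ^ Suc (Suc n) =
      2 * poly x u * ((poly x u + v) ^ Suc n - (poly x u - v) ^ Suc n)
      - ((poly x u)\<^sup>2 - v\<^sup>2) * ((poly x u + v) ^ n - (poly x u - v) ^ n)"
      by (simp add: algebra_simps power2_eq_square)
    also have "\<dots> = v * poly (smult 2 (x * p') - q * p) u"
      by (subst p(3)[OF v], subst p(4)[OF v], subst v) (simp add: algebra_simps)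
    finally show "(poly x u + v) ^ Suc (Suc n) - (poly x u - v) ^ Suc (Suc n) = v * poly (smult 2 (x * p') - q * p) u" .
  qed
next
  case 1
  show ?case by (rule exI[of _ "[:2:]"]) simp
qed (auto intro: exI[of _ 0])

locale quadratic_substitution =
  fixes a c :: real
  assumes pos: "\<forall>t\<in>{0..1}. c - a * (a + t) > 0 \<and> c - (a + 1) * (a + t) > 0 \<and> c - (a + t)\<^sup>2 > 0"
begin

definition "A t = c - a * (a + t)"
definition "B t = c - (a + 1) * (a + t)"
definition "D t = c - (a + t)\<^sup>2"
text \<open>The constants are endpoint values: \<open>P = A 0 = D 0\<close>,
  \<open>Q = B 1 = D 1\<close>, \<open>R = A 1 = B 0\<close>.\<close>

definition "P = c - a\<^sup>2"
definition "Q = c - (a + 1)\<^sup>2"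
definition "R = c - a * (a + 1)"
definition "U t = t * B t / D t"
text \<open>The radicand is the discriminant of \<open>t * B t = u * D t\<close>, read as a
  quadratic equation in \<open>t\<close>.\<close>

definition "V u = sqrt (R\<^sup>2 - 4 * c * (u * (1 - u)))"
definition "H u = R * (1 - 2 * u)"

lemma ABD_pos: "0 \<le> t \<Longrightarrow> t \<le> 1 \<Longrightarrow> A t > 0" "0 \<le> t \<Longrightarrow> t \<le> 1 \<Longrightarrow> B t > 0" "0 \<le> t \<Longrightarrow> t \<le> 1 \<Longrightarrow> D t > 0"
  using pos by (auto simp: A_def B_def D_def)

lemma PQR_pos: "P > 0" "Q > 0" "R > 0"
  using ABD_pos(3)[of 0] ABD_pos(3)[of 1] ABD_pos(1)[of 1]
  by (simp_all add: A_def D_def P_def Q_def R_def add.commute power2_eq_square)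

lemma D_split: "t * B t + (1 - t) * A t = D t"
  by (simp add: A_def B_def D_def power2_eq_square algebra_simps)

lemma one_minus_U: "0 \<le> t \<Longrightarrow> t \<le> 1 \<Longrightarrow> 1 - U t = (1 - t) * A t / D t"
  using ABD_pos(3)[of t] D_split[of t] by (simp add: U_def field_simps)

text \<open>Since \<open>R^2 - c = P * Q\<close>, the radicand is a sum of two nonnegative terms:
  the first is \<open>R^2\<close> at the endpoints, the second is positive between them.\<close>

lemma V_square: "(V u)\<^sup>2 = (H u)\<^sup>2 + 4 * P * Q * (u * (1 - u))" and V_pos: "V u > 0"
  if "u \<in> {0..1}"
proof -
  have eq: "R\<^sup>2 - 4 * c * (u * (1 - u)) = (H u)\<^sup>2 + 4 * P * Q * (u * (1 - u))"
    by (simp add: H_def P_def Q_def R_def power2_eq_square algebra_simps)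
  have "\<dots> > 0"
  proof (cases "u = 0")
    case True
    thus ?thesis using PQR_pos by (simp add: H_def)
  next
    case False
    show ?thesis
    proof (cases "u = 1")
      case True
      thus ?thesis using PQR_pos by (simp add: H_def)
    next
      case False
      hence "4 * P * Q * (u * (1 - u)) > 0"
        using that \<open>u \<noteq> 0\<close> PQR_pos by (intro mult_pos_pos) auto
      thus ?thesis by (intro add_nonneg_pos) auto
    qed
  qed
  thus "(V u)\<^sup>2 = (H u)\<^sup>2 + 4 * P * Q * (u * (1 - u))" "V u > 0"
    by (simp_all add: V_def eq)
qed

lemma V_reflect: "V (1 - u) = V u" and H_reflect: "H (1 - u) = - H u"
  by (simp_all add: V_def H_def algebra_simps)

text \<open>Put \<open>X = P * (1 - t) * B t\<close> and \<open>Y = Q * t * A t\<close>. Then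
  \<open>H (U t)\<close> is \<open>(X - Y) / D t\<close>, and adding
  \<open>4 * X * Y / (D t)^2\<close> to its square gives the square of \<open>(X + Y) / D t\<close>.
  By positivity this is \<open>V (U t)\<close>, and \<open>X + Y\<close> is also the numerator of
  the quotient rule for \<open>U\<close>.\<close>

lemma
  assumes t: "0 \<le> t" "t \<le> 1"
  shows U_range: "U t \<in> {0..1}"
    and V_plus_H: "V (U t) + H (U t) = 2 * P * (1 - t) * B t / D t"
    and V_minus_H: "V (U t) - H (U t) = 2 * Q * t * A t / D t"
    and U_deriv: "(U has_field_derivative V (U t) / D t) (at t)"
proof -
  have Dn: "D t \<noteq> 0" using ABD_pos(3)[OF t] by simp
  define W where "W = (P * (1 - t) * B t + Q * t * A t) / D t"
  have "W > 0"
    unfolding W_def using t PQR_pos ABD_pos[OF t]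
    by (cases "t = 0") (auto intro!: divide_pos_pos add_nonneg_pos)
  have "0 \<le> U t" "0 \<le> 1 - U t"
    unfolding one_minus_U[OF t] using t ABD_pos[OF t] by (auto simp: U_def)
  thus U: "U t \<in> {0..1}" by simp
  have UU: "U t * (1 - U t) = t * B t * ((1 - t) * A t) / (D t)\<^sup>2"
    unfolding one_minus_U[OF t] by (simp add: U_def power2_eq_square)
  have "R * ((1 - t) * A t - t * B t) = P * (1 - t) * B t - Q * t * A t"
    by (simp add: A_def B_def P_def Q_def R_def power2_eq_square algebra_simps)
  moreover have "H (U t) = R * ((1 - U t) - U t)" by (simp add: H_def)
  hence "H (U t) = R * ((1 - t) * A t - t * B t) / D t"
    unfolding one_minus_U[OF t] by (simp add: U_def flip: diff_divide_distrib)
  ultimately have H: "H (U t) = (P * (1 - t) * B t - Q * t * A t) / D t" by simp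
  have "(V (U t))\<^sup>2 = W\<^sup>2"
    unfolding V_square[OF U] H UU W_def using Dn 
    by (simp add: field_simps power2_eq_square)
  with \<open>W > 0\<close> V_pos[OF U] have V: "V (U t) = W"
    by (simp add: power2_eq_iff_nonneg)
  show "V (U t) + H (U t) = 2 * P * (1 - t) * B t / D t" "V (U t) - H (U t) = 2 * Q * t * A t / D t"
    unfolding V H W_def by (simp_all flip: add_divide_distrib diff_divide_distrib)
  have B': "(B has_field_derivative - (a + 1)) (at t)"
    unfolding B_def [abs_def] by (auto intro!: derivative_eq_intros)
  have D': "(D has_field_derivative - 2 * (a + t)) (at t)"
    unfolding D_def [abs_def] by (auto intro!: derivative_eq_intros)
  have eq: "(B t - t * (a + 1)) * D t + 2 * (a + t) * (t * B t) = P * (1 - t) * B t + Q * t * A t"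
    by (simp add: A_def B_def D_def P_def Q_def power2_eq_square algebra_simps)
  have "(U has_field_derivative ((B t - t * (a + 1)) * D t + 2 * (a + t) * (t * B t)) / (D t)\<^sup>2) (at t)"
    unfolding U_def [abs_def] using Dn
    by (auto intro!: derivative_eq_intros B' D' simp: power2_eq_square algebra_simps)
  thus "(U has_field_derivative V (U t) / D t) (at t)"
    unfolding V W_def eq by (simp add: power2_eq_square)
qed

lemma bij_U: "bij_betw U {0<..<1} {0<..<1}"
proof -
  have deriv: "\<exists>y. (U has_field_derivative y) (at t) \<and> y > 0" if "0 \<le> t" "t \<le> 1" for t
    using U_deriv[OF that] V_pos[OF U_range[OF that]] ABD_pos(3)[OF that] by (intro exI[of _ "V (U t) / D t"]) simp
  have mono: "U s < U t" if "0 \<le> s" "s < t" "t \<le> 1" for s t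
    using that by (intro DERIV_pos_imp_increasing[of s t U]) (auto intro!: deriv)
  have cont: "continuous_on {0..1} U"
    by (intro continuous_at_imp_continuous_on ballI) (auto intro: DERIV_isCont U_deriv)
  have U01: "U 0 = 0" "U 1 = 1"
    using ABD_pos(3)[of 1] by (auto simp: U_def B_def D_def power2_eq_square)
  have "inj_on U {0<..<1}"
  proof (rule linorder_inj_onI')
    fix s t :: real
    assume "s \<in> {0<..<1}" "t \<in> {0<..<1}" "s < t"
    thus "U s \<noteq> U t" using mono[of s t] by auto
  qed
  moreover have "U ` {0<..<1} = {0<..<1}"
  proof (intro equalityI subsetI)
    fix u assume "u \<in> {0<..<1 :: real}"
    then obtain t where "0 \<le> t" "t \<le> 1" "U t = u"
      using IVT'[of U 0 u 1] cont U01 by auto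
    thus "u \<in> U ` {0<..<1}" using \<open>u \<in> _\<close> U01 by (cases "t = 0 \<or> t = 1") auto
  qed (use mono[of 0] mono[of _ 1] U01 in auto)
  ultimately show ?thesis by (simp add: bij_betw_def)
qed

end

section \<open>Expansion of the integrand\<close>

text \<open>Expand the remaining power \<open>(1 - t + t * E) ^ (m - n)\<close> binomially. A term
  with \<open>i\<close> factors \<open>1 - t\<close> carries \<open>E\<close> to the power
  \<open>- (n + i)\<close>, so terms are collected by \<open>j = n + i\<close>.\<close>

lemma binomial_sum_expansion:
  fixes b :: "nat \<Rightarrow> 'a :: field_char_0"
  assumes "t \<noteq> 0" "E \<noteq> 0" "r \<noteq> 0" "1 - t + t * E \<noteq> 0"
  shows "(\<Sum>n\<le>m. b n * of_nat (m choose n) * (r / (1 - t + t * E)) ^ n) * ((1 - t + t * E) / E) ^ m / t ^ m =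
    (\<Sum>j\<le>m. of_nat (m choose j) / E ^ j * ((\<Sum>n\<le>j. b n * of_nat (j choose n) * ((1 - t) / r) ^ (j - n)) * (r / t) ^ j))"
proof -
  define s where "s = 1 - t + t * E"
  have "s \<noteq> 0" using assms by (simp add: s_def)
  define F where "F = (\<lambda>n j. of_nat (m choose j) / E ^ j * (b n * of_nat (j choose n) * ((1 - t) / r) ^ (j - n) * (r / t) ^ j))"
  have "b n * of_nat (m choose n) * (r / s) ^ n * ((s / E) ^ m / t ^ m) = (\<Sum>i\<le>m-n. F n (n + i))"
    if n: "n \<le> m" for n
  proof -
    have "b n * of_nat (m choose n) * (r / s) ^ n * ((s / E) ^ m / t ^ m) = 
          b n * of_nat (m choose n) * r ^ n / (t * E) ^ m * s ^ (m - n)"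
      using assms \<open>s \<noteq> 0\<close> n by (simp add: power_diff field_simps)
    also have "s ^ (m - n) = (\<Sum>i\<le>m-n. of_nat ((m - n) choose i) * (1 - t) ^ i * (t * E) ^ (m - n - i))"
      by (simp add: s_def binomial_ring)
    also have "b n * of_nat (m choose n) * r ^ n / (t * E) ^ m * \<dots> = (\<Sum>i\<le>m-n. F n (n + i))"
      unfolding sum_distrib_left
    proof (intro sum.cong refl)
      fix i assume "i \<in> {..m-n}"
      hence i: "n + i \<le> m" using n by simp
      have "(m choose (n + i)) * ((n + i) choose n) = (m choose n) * ((m - n) choose i)"
        using choose_mult[of n "n + i" m] i by simp
      hence c: "of_nat (m choose (n + i)) * of_nat ((n + i) choose n) = (of_nat (m choose n) * of_nat ((m - n) choose i) :: 'a)"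
        by (simp flip: of_nat_mult)
      have "(t * E) ^ (m - n - i) = (t * E) ^ m / (t * E) ^ (n + i)"
        using i assms by (simp add: power_diff diff_diff_left)
      hence "b n * of_nat (m choose n) * r ^ n / (t * E) ^ m * (of_nat ((m - n) choose i) * (1 - t) ^ i * (t * E) ^ (m - n - i)) = 
         (of_nat (m choose n) * of_nat ((m - n) choose i)) * (b n * r ^ n * (1 - t) ^ i / (t * E) ^ (n + i))"
        using assms by simp
      also have "\<dots> = F n (n + i)"
        using assms unfolding c [symmetric] by (simp add: F_def power_divide power_mult_distrib power_add mult_ac)
      finally show "b n * of_nat (m choose n) * r ^ n / (t * E) ^ m * (of_nat ((m - n) choose i) * (1 - t) ^ i * (t * E) ^ (m - n - i)) = F n (n + i)" .
    qed
    finally show ?thesis .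
  qed
  hence "(\<Sum>n\<le>m. b n * of_nat (m choose n) * (r / s) ^ n) * (s / E) ^ m / t ^ m = (\<Sum>n\<le>m. \<Sum>i\<le>m-n. F n (n + i))"
    by (simp add: sum_distrib_right sum_divide_distrib)
  also have "\<dots> = (\<Sum>j\<le>m. \<Sum>n\<le>j. F n j)"
    by (simp add: sum.Sigma,
        rule sum.reindex_bij_witness[of _ "\<lambda>(j, n). (n, j - n)" "\<lambda>(n, i). (n + i, n)"]) auto
  also have "\<dots> = (\<Sum>j\<le>m. of_nat (m choose j) / E ^ j * ((\<Sum>n\<le>j. b n * of_nat (j choose n) * ((1 - t) / r) ^ (j - n)) * (r / t) ^ j))"
    by (simp add: F_def sum_distrib_left sum_distrib_right)
  finally show ?thesis by (simp add: s_def)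
qed

text \<open>All dependence on \<open>m\<close> is confined to the binomial coefficient, so the same
  sequence of remaining factors serves every degree \<open>j\<close>.\<close>

lemma hypergeometric_coefficient:
  "pochhammer b n * pochhammer (- of_nat m) n / (fact n * pochhammer g n) =
   pochhammer b n * (- 1) ^ n / pochhammer g n * (of_nat (m choose n) :: 'a :: field_char_0)"
proof -
  have "pochhammer b n * pochhammer (- of_nat m) n / (fact n * pochhammer g n) =
        pochhammer b n / pochhammer g n * (pochhammer (- of_nat m) n / fact n)"
    by simp
  thus ?thesis by (simp add: pochhammer_neg_of_nat)
qed

lemma hyp2F1_poly_expansion:
  fixes t E r :: complex
  assumes "t \<noteq> 0" "E \<noteq> 0" "r \<noteq> 0" "1 - t + t * E \<noteq> 0"
  shows "hyp2F1_poly (- \<beta>) m (- 2 * \<beta>) (r / (1 - t + t * E)) * ((1 - t + t * E) / E) ^ m / t ^ m =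
    (\<Sum>j\<le>m. of_nat (m choose j) / E ^ j * (ultra \<beta> j (1 - (1 - t) / r) * (r / t) ^ j))"
  unfolding hyp2F1_poly_def ultra_def hypergeometric_coefficient
  using binomial_sum_expansion[OF assms, of "\<lambda>n. pochhammer (- \<beta>) n * (- 1) ^ n / pochhammer (- 2 * \<beta>) n" m]
  by simp

lemma continuous_on_ultra [continuous_intros]:
  "continuous_on X f \<Longrightarrow> continuous_on X (\<lambda>u. ultra \<beta> j (f u))"
  unfolding ultra_def by (intro continuous_intros)

section \<open>Integrals of the coefficients of the expansion\<close>

context quadratic_substitution
begin

text \<open>With \<open>y = D t / (A t * t)\<close> the last factor is
  \<open>y ^ (j - 1) / D t\<close>, written so that \<open>j = 0\<close> is covered without a
  negative exponent. The remaining \<open>1 / D t\<close> is part of the Jacobian of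
  \<open>U\<close>.\<close>

definition kernel :: "complex \<Rightarrow> nat \<Rightarrow> real \<Rightarrow> complex" where
  "kernel \<beta> j t = of_real (U t) powr (\<beta> - 1) * of_real (1 - U t) powr (\<beta> - 1) *
     (ultra \<beta> j (of_real (U t)) * of_real ((D t / (A t * t)) ^ j * (A t * t / (D t)\<^sup>2)))"

lemma continuous_on_V [continuous_intros]:
  "continuous_on X V" "continuous_on X H"
  unfolding V_def [abs_def] H_def [abs_def] by (intro continuous_intros)+

text \<open>Change of variables along \<open>U\<close>, followed by symmetrisation. The exponent
  \<open>z\<close> is kept apart from \<open>\<beta>\<close> because for positive \<open>j\<close>
  some factors \<open>u * (1 - u)\<close> leave the weight.\<close>

lemma kernel_transform:
  assumes g: "continuous_on {0..1} g" and z: "Re z > 0"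
    and I: "((\<lambda>u. complex_of_real u powr (z - 1) * of_real (1 - u) powr (z - 1) * (g u + g (1 - u))) has_integral I) {0..1}"
    and eq: "\<And>t. t \<in> {0<..<1} \<Longrightarrow>
       kernel \<beta> j t = of_real (V (U t) / D t) * (of_real (U t) powr (z - 1) * of_real (1 - U t) powr (z - 1) * g (U t))"
  shows "(kernel \<beta> j has_integral I / 2) {0<..<1}"
proof -
  let ?f = "\<lambda>u. complex_of_real u powr (z - 1) * of_real (1 - u) powr (z - 1) * g u"
  have "?f absolutely_integrable_on {0<..<1}" 
    using absolutely_integrable_Beta_continuous[OF z z g] by (simp add: absolutely_integrable_on_Icc_iff_Ioo)
  moreover have "(?f has_integral I / 2) {0<..<1}"
    using has_integral_Beta_symmetrise[OF z g I] by (simp add: has_integral_Icc_iff_Ioo)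
  ultimately have "(\<lambda>t. \<bar>V (U t) / D t\<bar> *\<^sub>R ?f (U t)) absolutely_integrable_on {0<..<1} \<and>
    integral {0<..<1} (\<lambda>t. \<bar>V (U t) / D t\<bar> *\<^sub>R ?f (U t)) = I / 2"
    using bij_U has_field_derivative_at_within[OF U_deriv]
    by (subst has_absolute_integral_change_of_variables_real) (auto simp: bij_betw_def has_integral_iff)
  hence "((\<lambda>t. \<bar>V (U t) / D t\<bar> *\<^sub>R ?f (U t)) has_integral I / 2) {0<..<1}"
    by (simp add: has_integral_iff absolutely_integrable_on_def)
  thus ?thesis
  proof (rule has_integral_eq [rotated])
    fix t :: real assume t: "t \<in> {0<..<1}"
    hence "V (U t) / D t > 0"
      using V_pos[OF U_range, of t] ABD_pos(3)[of t] by simp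
    thus "\<bar>V (U t) / D t\<bar> *\<^sub>R ?f (U t) = kernel \<beta> j t"
      unfolding eq[OF t] by (simp only: abs_of_pos scaleR_conv_of_real)
  qed
qed

lemma has_integral_kernel_0:
  assumes \<beta>: "Re \<beta> > 0"
  shows "(kernel \<beta> 0 has_integral Beta \<beta> \<beta> / of_real (2 * Q)) {0<..<1}"
proof -
  \<comment> \<open>Obtained from \<open>V_minus_H\<close> on dividing
    \<open>A t * t / (D t)^2\<close> by the Jacobian. As \<open>V\<close> is even and
    \<open>H\<close> odd under reflection, \<open>g u + g (1 - u)\<close> is constant.\<close>
  define g where "g = (\<lambda>u. complex_of_real ((V u - H u) / (2 * Q * V u)))"
  have V: "V u \<noteq> 0" if "u \<in> {0..1}" for u
    using V_pos[OF that] by simp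
  have "(kernel \<beta> 0 has_integral Beta \<beta> \<beta> * of_real (1 / Q) / 2) {0<..<1}"
  proof (rule kernel_transform[OF _ \<beta>])
    show "continuous_on {0..1} g"
      unfolding g_def using PQR_pos V by (intro continuous_intros) auto
    have "((\<lambda>u. complex_of_real u powr (\<beta> - 1) * of_real (1 - u) powr (\<beta> - 1) * of_real (1 / Q)) 
      has_integral Beta \<beta> \<beta> * of_real (1 / Q)) {0..1}"
      by (intro has_integral_mult_left has_integral_Beta_complex \<beta>)
    thus "((\<lambda>u. complex_of_real u powr (\<beta> - 1) * of_real (1 - u) powr (\<beta> - 1) * (g u + g (1 - u)))
      has_integral Beta \<beta> \<beta> * of_real (1 / Q)) {0..1}"
    proof (rule has_integral_eq [rotated])
      fix u :: real assume u: "u \<in> {0..1}"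
      have "(V u - H u) / (2 * Q * V u) + (V (1 - u) - H (1 - u)) / (2 * Q * V (1 - u)) = 1 / Q"
        using V[OF u] PQR_pos by (simp add: V_reflect H_reflect field_simps)
      hence "g u + g (1 - u) = of_real (1 / Q)"
        unfolding g_def by (simp only: of_real_add [symmetric])
      thus "complex_of_real u powr (\<beta> - 1) * of_real (1 - u) powr (\<beta> - 1) * of_real (1 / Q) =
        complex_of_real u powr (\<beta> - 1) * of_real (1 - u) powr (\<beta> - 1) * (g u + g (1 - u))"
        by simp
    qed
  next
    fix t :: real assume t: "t \<in> {0<..<1}"
    have "V (U t) / D t * ((V (U t) - H (U t)) / (2 * Q * V (U t))) = A t * t / (D t)\<^sup>2"
      using V[OF U_range, of t] t PQR_pos by (subst V_minus_H) (auto simp: power2_eq_square)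
    hence "of_real (V (U t) / D t) * g (U t) = of_real (A t * t / (D t)\<^sup>2)"
      unfolding g_def by (simp only: of_real_mult [symmetric])
    thus "kernel \<beta> 0 t = of_real (V (U t) / D t) * (of_real (U t) powr (\<beta> - 1) * of_real (1 - U t) powr (\<beta> - 1) * g (U t))"
      by (simp add: kernel_def ultra_def mult_ac del: of_real_diff of_real_mult of_real_divide)
  qed
  thus ?thesis by (simp add: mult.commute)
qed

text \<open>Each factor \<open>u * (1 - u) * y\<close> equals \<open>(V + H) / (2 * P)\<close>.
  Moving \<open>j - 1\<close> such factors out of the weight leaves \<open>ultra\<close> times
  \<open>k\<close>; by the parity of \<open>ultra\<close>, symmetrising replaces \<open>k\<close> by
  a polynomial of degree less than \<open>j\<close>, and orthogonality applies.\<close>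

lemma has_integral_kernel_pos:
  assumes \<beta>: "Re \<beta> > real j - 1" and nz: "pochhammer (- 2 * \<beta>) j \<noteq> 0" and j: "j > 0"
  shows "(kernel \<beta> j has_integral 0) {0<..<1}"
proof -
  define n where "n = j - 1"
  define k where "k = (\<lambda>u. (V u + H u) ^ n / ((2 * P) ^ n * V u))"
  define g where "g = (\<lambda>u. ultra \<beta> j (of_real u) * complex_of_real (k u))"
  have V: "V u \<noteq> 0" if "u \<in> {0..1}" for u
    using V_pos[OF that] by simp
  \<comment> \<open>The two polynomials represent \<open>H u\<close> and
    \<open>(H u)^2 - (V u)^2\<close>.\<close>
  have "degree [:R, - 2 * R:] \<le> 1" "degree [:0, - 4 * P * Q, 4 * P * Q:] \<le> 2"
    by simp_all
  from power_diff_poly[OF this, of n] obtain p where p: "degree p \<le> n"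
    "\<And>u v. poly [:R, - 2 * R:] u ^ 2 - v ^ 2 = poly [:0, - 4 * P * Q, 4 * P * Q:] u \<Longrightarrow>
      (poly [:R, - 2 * R:] u + v) ^ n - (poly [:R, - 2 * R:] u - v) ^ n = v * poly p u" by blast
  have H: "poly [:R, - 2 * R:] u = H u" for u by (simp add: H_def algebra_simps)
  have pV: "(H u + V u) ^ n - (H u - V u) ^ n = V u * poly p u" if "u \<in> {0..1}" for u
    using p(2)[of u "V u"] V_square[OF that] unfolding H by (simp add: algebra_simps power2_eq_square)
  have kk: "k u + (-1) ^ j * k (1 - u) = poly (smult (1 / (2 * P) ^ n) p) u" if "u \<in> {0..1}" for u
  proof -
    \<comment> \<open>As \<open>j = n + 1\<close>, the parities differ: the reflected term enters
      with a minus sign, producing the difference of powers that is divisible by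
      \<open>V u\<close>.\<close>
    have "(-1) ^ j * (V u - H u) ^ n = - ((H u - V u) ^ n)"
    proof -
      have "(H u - V u) ^ n = ((-1) * (V u - H u)) ^ n" by simp
      also have "\<dots> = (-1) ^ n * (V u - H u) ^ n" by (rule power_mult_distrib)
      finally show ?thesis using j by (cases j) (simp_all add: n_def)
    qed
    hence "k u + (-1) ^ j * k (1 - u) = ((H u + V u) ^ n - (H u - V u) ^ n) / ((2 * P) ^ n * V u)"
      by (simp add: k_def V_reflect H_reflect add_divide_distrib diff_divide_distrib add.commute)
    thus ?thesis using V[OF that] by (simp add: pV[OF that])
  qed
  have "(kernel \<beta> j has_integral 0 / 2) {0<..<1}"
  proof (rule kernel_transform[where z = "\<beta> - of_nat j + 1" and g = g])
    show "continuous_on {0..1} g"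
      unfolding g_def k_def using PQR_pos V by (intro continuous_intros) auto
    show "Re (\<beta> - of_nat j + 1) > 0" using \<beta> by simp
    have "((\<lambda>u. complex_of_real u powr (\<beta> - of_nat j) * of_real (1 - u) powr (\<beta> - of_nat j) * 
        (ultra \<beta> j (of_real u) * of_real (poly (smult (1 / (2 * P) ^ n) p) u))) has_integral 0) {0..1}"
      using p(1) j by (intro has_integral_ultra_poly \<beta> nz) (auto simp: n_def)
    thus "((\<lambda>u. complex_of_real u powr (\<beta> - of_nat j + 1 - 1) * of_real (1 - u) powr (\<beta> - of_nat j + 1 - 1) * (g u + g (1 - u)))
      has_integral 0) {0..1}"
    proof (rule has_integral_eq [rotated])
      fix u :: real assume u: "u \<in> {0..1}"
      have "g u + g (1 - u) = ultra \<beta> j (of_real u) * of_real (k u + (-1) ^ j * k (1 - u))"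
        using ultra_reflect[OF nz, of "of_real u"] by (simp add: g_def algebra_simps)
      thus "complex_of_real u powr (\<beta> - of_nat j) * of_real (1 - u) powr (\<beta> - of_nat j) * 
        (ultra \<beta> j (of_real u) * of_real (poly (smult (1 / (2 * P) ^ n) p) u)) =
        complex_of_real u powr (\<beta> - of_nat j + 1 - 1) * of_real (1 - u) powr (\<beta> - of_nat j + 1 - 1) * (g u + g (1 - u))"
        unfolding kk[OF u] by simp
    qed
  next
    fix t :: real assume t: "t \<in> {0<..<1}"
    note pos = ABD_pos[of t] 
    have U: "U t > 0" "1 - U t > 0"
      using pos t by (auto simp: one_minus_U) (auto simp: U_def)
    have "(V (U t) + H (U t)) / (2 * P) = D t / (A t * t) * (U t * (1 - U t))"
      using pos t PQR_pos by (simp add: V_plus_H one_minus_U) (simp add: U_def field_simps power2_eq_square)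
    hence "((V (U t) + H (U t)) / (2 * P)) ^ n = (D t / (A t * t)) ^ n * (U t ^ n * (1 - U t) ^ n)"
      by (simp only: power_mult_distrib)
    moreover have "V (U t) / D t * k (U t) = ((V (U t) + H (U t)) / (2 * P)) ^ n / D t"
      using V[OF U_range, of t] t by (simp add: k_def power_divide)
    ultimately have "V (U t) / D t * k (U t) = (D t / (A t * t)) ^ n * (U t ^ n * (1 - U t) ^ n) / D t"
      by simp
    also have "\<dots> = (U t ^ n * (1 - U t) ^ n) * ((D t / (A t * t)) ^ j * (A t * t / (D t)\<^sup>2))"
      using pos t j by (cases j) (simp_all add: n_def power2_eq_square field_simps)
    finally have k: "of_real (V (U t) / D t) * complex_of_real (k (U t)) = 
       (of_real (U t) ^ n * of_real (1 - U t) ^ n) * of_real ((D t / (A t * t)) ^ j * (A t * t / (D t)\<^sup>2))"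
      by (simp only: of_real_mult [symmetric] of_real_power [symmetric])
    have "complex_of_real x powr (\<beta> - 1) = of_real x powr (\<beta> - of_nat j) * of_real x ^ n" if "x > 0" for x
    proof -
      have "\<beta> - 1 = (\<beta> - of_nat j) + of_nat n" using j by (simp add: n_def of_nat_diff)
      thus ?thesis using that by (simp only: powr_add powr_complexpow) simp
    qed
    from this[OF U(1)] this[OF U(2)] 
    have "kernel \<beta> j t = of_real (U t) powr (\<beta> - of_nat j) * of_real (1 - U t) powr (\<beta> - of_nat j) *
       (ultra \<beta> j (of_real (U t)) * ((of_real (U t) ^ n * of_real (1 - U t) ^ n) * of_real ((D t / (A t * t)) ^ j * (A t * t / (D t)\<^sup>2))))"
      unfolding kernel_def by (simp only: mult_ac)
    thus "kernel \<beta> j t = of_real (V (U t) / D t) * 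
      (of_real (U t) powr (\<beta> - of_nat j + 1 - 1) * of_real (1 - U t) powr (\<beta> - of_nat j + 1 - 1) * g (U t))"
      unfolding k [symmetric] g_def by (simp add: mult_ac del: of_real_diff of_real_mult of_real_divide)
  qed
  thus ?thesis by simp
qed

section \<open>Reassembly of the integrand\<close>

lemma integrand_expansion:
  assumes t: "t \<in> {0<..<1}" and e: "e < 1"
  shows "of_real (A t) powr \<beta> * of_real (B t) powr (\<beta> - 1) / of_real (D t) powr (2 * \<beta>)
      * hyp2F1_poly (- \<beta>) m (- 2 * \<beta>) (of_real (D t / (A t * (1 - e * t))))
      * of_real (((1 - e * t) / (1 - e)) ^ m)
      * of_real t powr (\<beta> - of_nat m) * of_real (1 - t) powr (\<beta> - 1) =
    (\<Sum>j\<le>m. of_nat (m choose j) / of_real (1 - e) ^ j * kernel \<beta> j t)"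
proof -
  have t01: "0 \<le> t" "t \<le> 1" "0 < t" "0 < 1 - t" using t by auto
  note pos = ABD_pos[OF t01(1,2)]
  have et: "1 - e * t > 0"
  proof -
    have "1 - e * t = (1 - t) + (1 - e) * t" by (simp add: algebra_simps)
    also have "\<dots> > 0" using t01 e by (intro add_pos_pos mult_pos_pos) auto
    finally show ?thesis .
  qed
  define w where "w = complex_of_real (U t) powr (\<beta> - 1) * of_real (1 - U t) powr (\<beta> - 1)"
  have shift: "complex_of_real x powr (z + 1) = of_real x powr z * of_real x" if "x > 0" for x z
    using that by (simp add: powr_add)
  \<comment> \<open>From \<open>D t * U t = t * B t\<close> and
    \<open>D t * (1 - U t) = (1 - t) * A t\<close>; real nonnegative bases allow principal powers to
    be multiplied.\<close>
  have Dw: "(complex_of_real (D t) powr (\<beta> - 1))\<^sup>2 * w = 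
    of_real t powr (\<beta> - 1) * of_real (B t) powr (\<beta> - 1) * of_real (1 - t) powr (\<beta> - 1) * of_real (A t) powr (\<beta> - 1)"
  proof -
    have U: "0 \<le> U t" "0 \<le> 1 - U t" using U_range[OF t01(1,2)] by auto
    have "complex_of_real (D t) powr (\<beta> - 1) * of_real (U t) powr (\<beta> - 1) = of_real (D t * U t) powr (\<beta> - 1)"
      using pos U by (simp add: powr_times_real)
    also have "D t * U t = t * B t" using pos by (simp add: U_def)
    finally have 1: "complex_of_real (D t) powr (\<beta> - 1) * of_real (U t) powr (\<beta> - 1) = of_real t powr (\<beta> - 1) * of_real (B t) powr (\<beta> - 1)"
      using pos t01 by (simp add: powr_times_real)
    have "complex_of_real (D t) powr (\<beta> - 1) * of_real (1 - U t) powr (\<beta> - 1) = of_real (D t * (1 - U t)) powr (\<beta> - 1)"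
      using pos U by (simp add: powr_times_real del: of_real_diff)
    also have "D t * (1 - U t) = (1 - t) * A t" using pos t01 by (simp add: one_minus_U)
    finally have 2: "complex_of_real (D t) powr (\<beta> - 1) * of_real (1 - U t) powr (\<beta> - 1) = of_real (1 - t) powr (\<beta> - 1) * of_real (A t) powr (\<beta> - 1)"
      using pos t01 by (simp add: powr_times_real del: of_real_diff)
    have "(complex_of_real (D t) powr (\<beta> - 1))\<^sup>2 * w = 
       (complex_of_real (D t) powr (\<beta> - 1) * of_real (U t) powr (\<beta> - 1)) * (complex_of_real (D t) powr (\<beta> - 1) * of_real (1 - U t) powr (\<beta> - 1))"
      by (simp only: w_def power2_eq_square mult_ac)
    thus ?thesis unfolding 1 2 by (simp only: mult_ac)
  qed
  have D2: "complex_of_real (D t) powr (2 * \<beta>) = (complex_of_real (D t) powr (\<beta> - 1))\<^sup>2 * of_real (D t) ^ 2"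
  proof -
    have "2 * \<beta> = (\<beta> - 1) + (\<beta> - 1) + of_nat 2" by simp
    thus ?thesis using pos by (simp only: powr_add powr_complexpow) (simp add: power2_eq_square)
  qed
  have tm: "of_real t powr (\<beta> - of_nat m) = complex_of_real t powr (\<beta> - 1) * of_real t / of_real t ^ m"
    using t01 shift[of t "\<beta> - 1"] by (simp add: powr_diff)
  have Ab: "complex_of_real (A t) powr \<beta> = of_real (A t) powr (\<beta> - 1) * of_real (A t)"
    using shift[of "A t" "\<beta> - 1"] pos by simp
  have pre: "of_real (A t) powr \<beta> * of_real (B t) powr (\<beta> - 1) / of_real (D t) powr (2 * \<beta>) 
      * of_real t powr (\<beta> - of_nat m) * of_real (1 - t) powr (\<beta> - 1) =
      w * of_real (A t * t / (D t)\<^sup>2) / of_real t ^ m"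
  proof -
    have "of_real (A t) powr \<beta> * of_real (B t) powr (\<beta> - 1) / of_real (D t) powr (2 * \<beta>) 
        * of_real t powr (\<beta> - of_nat m) * of_real (1 - t) powr (\<beta> - 1) =
      (of_real t powr (\<beta> - 1) * of_real (B t) powr (\<beta> - 1) * of_real (1 - t) powr (\<beta> - 1) * of_real (A t) powr (\<beta> - 1)) /
      (complex_of_real (D t) powr (\<beta> - 1))\<^sup>2 * of_real (A t * t / (D t)\<^sup>2) / of_real t ^ m"
      unfolding Ab D2 tm by (simp add: mult_ac del: of_real_diff)
    also have "\<dots> = w * of_real (A t * t / (D t)\<^sup>2) / of_real t ^ m"
      unfolding Dw [symmetric] using pos by (simp del: of_real_diff)
    finally show ?thesis .
  qed
  define E where "E = complex_of_real (1 - e)"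
  define r where "r = complex_of_real (D t / A t)"
  define T where "T = complex_of_real t"
  have nz: "T \<noteq> 0" "E \<noteq> 0" "r \<noteq> 0" using e pos t01 by (auto simp: T_def E_def r_def)
  have s: "of_real (1 - e * t) = 1 - T + T * E" by (simp add: T_def E_def algebra_simps)
  have s0: "1 - T + T * E \<noteq> 0" using et unfolding s [symmetric] of_real_eq_0_iff by simp
  \<comment> \<open>This identifies the argument of \<open>ultra\<close> in the expansion with the
    new variable.\<close>
  have U1: "1 - (1 - T) / r = of_real (U t)"
  proof -
    have "1 - (1 - t) / (D t / A t) = U t" using one_minus_U[OF t01(1,2)] by simp
    hence "complex_of_real (1 - (1 - t) / (D t / A t)) = of_real (U t)" by (rule arg_cong)
    thus ?thesis by (simp add: T_def r_def)
  qed
  have "hyp2F1_poly (- \<beta>) m (- 2 * \<beta>) (of_real (D t / (A t * (1 - e * t)))) * of_real (((1 - e * t) / (1 - e)) ^ m) / of_real t ^ m =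
    hyp2F1_poly (- \<beta>) m (- 2 * \<beta>) (r / (1 - T + T * E)) * ((1 - T + T * E) / E) ^ m / T ^ m"
    unfolding s [symmetric] by (simp add: r_def E_def T_def)
  also have "\<dots> = (\<Sum>j\<le>m. of_nat (m choose j) / E ^ j * (ultra \<beta> j (of_real (U t)) * (r / T) ^ j))"
    unfolding hyp2F1_poly_expansion[OF nz s0] U1 ..
  finally have hyp: "hyp2F1_poly (- \<beta>) m (- 2 * \<beta>) (of_real (D t / (A t * (1 - e * t)))) * of_real (((1 - e * t) / (1 - e)) ^ m) / of_real t ^ m =
    (\<Sum>j\<le>m. of_nat (m choose j) / E ^ j * (ultra \<beta> j (of_real (U t)) * (r / T) ^ j))" .
  have "of_real (A t) powr \<beta> * of_real (B t) powr (\<beta> - 1) / of_real (D t) powr (2 * \<beta>)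
      * hyp2F1_poly (- \<beta>) m (- 2 * \<beta>) (of_real (D t / (A t * (1 - e * t))))
      * of_real (((1 - e * t) / (1 - e)) ^ m)
      * of_real t powr (\<beta> - of_nat m) * of_real (1 - t) powr (\<beta> - 1) =
    (of_real (A t) powr \<beta> * of_real (B t) powr (\<beta> - 1) / of_real (D t) powr (2 * \<beta>) 
      * of_real t powr (\<beta> - of_nat m) * of_real (1 - t) powr (\<beta> - 1)) *
    (hyp2F1_poly (- \<beta>) m (- 2 * \<beta>) (of_real (D t / (A t * (1 - e * t)))) * of_real (((1 - e * t) / (1 - e)) ^ m))"
    by (simp only: mult_ac times_divide_eq_left times_divide_eq_right)
  also have "\<dots> = w * of_real (A t * t / (D t)\<^sup>2) * 
    (hyp2F1_poly (- \<beta>) m (- 2 * \<beta>) (of_real (D t / (A t * (1 - e * t)))) * of_real (((1 - e * t) / (1 - e)) ^ m) / of_real t ^ m)"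
    unfolding pre by (simp only: times_divide_eq_left times_divide_eq_right)
  also have "\<dots> = (\<Sum>j\<le>m. of_nat (m choose j) / of_real (1 - e) ^ j * kernel \<beta> j t)"
    unfolding hyp sum_distrib_left
    by (intro sum.cong refl) (simp add: kernel_def w_def [symmetric] E_def r_def T_def power_divide mult_ac del: of_real_diff)
  finally show ?thesis .
qed

lemma has_integral_integrand:
  assumes "Re \<beta> > 0" "Re \<beta> > real m - 1" and e: "e < 1"
  shows "((\<lambda>t. of_real (A t) powr \<beta> * of_real (B t) powr (\<beta> - 1) / of_real (D t) powr (2 * \<beta>)
      * hyp2F1_poly (- \<beta>) m (- 2 * \<beta>) (of_real (D t / (A t * (1 - e * t))))
      * of_real (((1 - e * t) / (1 - e)) ^ m)
      * of_real t powr (\<beta> - of_nat m) * of_real (1 - t) powr (\<beta> - 1)) has_integral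
    Beta \<beta> \<beta> / of_real (2 * Q)) {0..1}"
proof -
  \<comment> \<open>A zero would make \<open>2 * Re \<beta>\<close> an integer at most
    \<open>m - 1\<close>, hence less than \<open>Re \<beta>\<close>, against positivity.\<close>
  have nz: "pochhammer (- 2 * \<beta>) j \<noteq> 0" if "j \<le> m" for j
  proof
    assume "pochhammer (- 2 * \<beta>) j = 0"
    then obtain k where k: "k < j" "- 2 * \<beta> = - of_nat k"
      by (auto simp: pochhammer_eq_0_iff)
    from k(2) have "Re (- 2 * \<beta>) = Re (- of_nat k)" by (simp only:)
    hence "2 * Re \<beta> = real k" by simp
    with k(1) that assms show False by linarith
  qed
  \<comment> \<open>Only \<open>j = 0\<close> contributes, with coefficient 1, which is why the
    integral depends neither on \<open>m\<close> nor on \<open>e\<close>.\<close>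
  have "(\<lambda>t. \<Sum>j\<le>m. of_nat (m choose j) / of_real (1 - e) ^ j * kernel \<beta> j t) = 
     (\<lambda>t. kernel \<beta> 0 t + (\<Sum>j\<in>{1..m}. of_nat (m choose j) / of_real (1 - e) ^ j * kernel \<beta> j t))"
    by (simp add: sum.atLeast_Suc_atMost flip: atLeast0AtMost)
  moreover have "((\<lambda>t. kernel \<beta> 0 t + (\<Sum>j\<in>{1..m}. of_nat (m choose j) / of_real (1 - e) ^ j * kernel \<beta> j t))
      has_integral (Beta \<beta> \<beta> / of_real (2 * Q) + (\<Sum>j\<in>{1..m}. of_nat (m choose j) / of_real (1 - e) ^ j * 0))) {0<..<1}"
    using assms by (intro has_integral_add has_integral_sum has_integral_mult_right has_integral_kernel_0 has_integral_kernel_pos nz) auto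
  ultimately have "((\<lambda>t. \<Sum>j\<le>m. of_nat (m choose j) / of_real (1 - e) ^ j * kernel \<beta> j t)
      has_integral Beta \<beta> \<beta> / of_real (2 * Q)) {0<..<1}"
    by simp
  thus ?thesis
    unfolding has_integral_Icc_iff_Ioo
    by (rule has_integral_eq [rotated]) (rule integrand_expansion [OF _ e, symmetric])
qed

end

theorem theorem5p2:
  fixes m :: nat and \<beta> :: complex and e a c :: real
  assumes "Re \<beta> > max 0 (real m - 1)"
    and "e < 1"
    and "\<forall>t\<in>{0..1::real}. c - a * (a + t) > 0 \<and> c - (a + 1) * (a + t) > 0 \<and> c - (a + t)\<^sup>2 > 0"
  defines "f \<equiv> (\<lambda>t::real.
      of_real (c - a * (a + t)) powr \<beta> * of_real (c - (a + 1) * (a + t)) powr (\<beta> - 1)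
      / of_real (c - (a + t)\<^sup>2) powr (2 * \<beta>)
      * hyp2F1_poly (- \<beta>) m (- 2 * \<beta>)
          (of_real ((c - (a + t)\<^sup>2) / ((c - a * (a + t)) * (1 - e * t))))
      * of_real (((1 - e * t) / (1 - e)) ^ m)
      * of_real t powr (\<beta> - of_nat m) * of_real (1 - t) powr (\<beta> - 1))"
  shows "f integrable_on {0..1} \<and>
    Gamma \<beta> * Gamma \<beta> / (2 * Gamma (2 * \<beta>)) = of_real (c - (a + 1)\<^sup>2) * integral {0..1} f"
proof -
  interpret quadratic_substitution a c
    using assms(3) by unfold_locales
  have "(f has_integral Beta \<beta> \<beta> / of_real (2 * Q)) {0..1}"
    using has_integral_integrand[of \<beta> m e] assms(1,2) unfolding f_def A_def B_def D_def by simp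
  hence "f integrable_on {0..1}" "integral {0..1} f = Beta \<beta> \<beta> / of_real (2 * Q)"
    by (simp_all add: has_integral_iff)
  moreover have "of_real (c - (a + 1)\<^sup>2) = complex_of_real Q" by (simp add: Q_def)
  moreover have "Beta \<beta> \<beta> = Gamma \<beta> * Gamma \<beta> / Gamma (2 * \<beta>)"
    by (simp only: Beta_def mult_2)
  ultimately show ?thesis
    using PQR_pos(2) by simp
qed

end
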